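(* Let $\Omega=\mathbb{T}^1$, $\beta>0$, let $P$ and $\mu$ be smooth functions on $(0,\infty)$ with $\mu>0$, and consider the barotropic compressible Navier--Stokes system $$\partial_t\rho+\partial_xm=0,\qquad \partial_tm+\partial_x\Big(\frac{m^2}{\rho}\Big)+\partial_xP(\rho)=\beta\,\partial_x\Big(\mu(\rho)\partial_x\frac m\rho\Big).\qquad( * )$$ There exist an entropy function, an entropy flux, a Fisher information and a metric operator for $( * )$, as follows. (i) (Entropy--entropy flux) Define $G,\Psi\colon(0,\infty)\times\mathbb{R}\to\mathbb{R}$ by $$G(\rho,m)=\frac{m^2}{2\rho}+\hat P(\rho),\qquad \Psi(\rho,m)=\frac{m^3}{2\rho^2}+\hat P'(\rho)m,$$ where $\hat P\colon(0,\infty)\to\mathbb{R}$ satisfies $\hat P''(\rho)=\frac{P'(\rho)}{\rho}$. If $(\rho(t,x),m(t,x))$ satisfies $( * )$ with $\beta=0$, then $$\partial_tG(\rho(t,x),m(t,x))+\partial_x\big(\Psi(\rho(t,x),m(t,x))\big)\le 0.$$ (ii) (Metric) Let $$\mathcal{M}=\Big\{(\rho,m)\in C^\infty(\Omega)^2\colon\rho>0,\ \int_\Omega\rho\,dx=c_1,\ \int_\Omega m\,dx=c_2\Big\},$$ with constants $c_1>0$, $c_2\in\mathbb{R}$, and tangent space at $u=(\rho,m)\in\mathcal{M}$ $$T_u\mathcal{M}=\Big\{(\dot\rho,\dot m)\in C^\infty(\Omega)^2\colon\int_\Omega\dot\rho\,dx=0,\ \int_\Omega\dot m\,dx=0\Big\}.$$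 Then the (degenerate) metric $\mathrm{g}\colon\mathcal{M}\times T_u\mathcal{M}\times T_u\mathcal{M}\to\mathbb{R}$ is given by $$\mathrm{g}(\rho,m)\big((\dot\rho_1,\dot m_1),(\dot\rho_2,\dot m_2)\big)=\int_\Omega\partial_x\psi_1(x)\,\partial_x\psi_2(x)\,\mu(\rho(x))\,dx,$$ where $(\dot\rho_i,\dot m_i)\in T_u\mathcal{M}$ and $\psi_i$ satisfies $\dot m_i=-\partial_x(\mu(\rho)\partial_x\psi_i)$, $i=1,2$. (iii) (Fisher information dissipation) Let $\mathcal{G}(\rho,m)=\int_\Omega G(\rho(x),m(x))\,dx$. If $(\rho(t,x),m(t,x))$ satisfies $( * )$, then $\mathcal{G}$ is a Lyapunov functional; precisely, $$\frac{d}{dt}\mathcal{G}(\rho(t,\cdot),m(t,\cdot))=-\beta\,\mathcal{I}_{\mathcal{G}}(\rho(t,\cdot),m(t,\cdot))\le 0,$$ where $$\mathcal{I}_{\mathcal{G}}(\rho,m)=\int_\Omega\Big|\partial_x\frac{\delta}{\delta m}\mathcal{G}(\rho,m)(x)\Big|^2\mu(\rho(x))\,dx=\int_\Omega\Big|\partial_x\frac{m(x)}{\rho(x)}\Big|^2\mu(\rho(x))\,dx.$$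
   Context: $\mathbb{T}^1$ is the one-dimensional torus (periodic boundary conditions). Solutions $(\rho,m)$ are smooth with $\rho>0$; here $m=\rho v$ where $v$ is the velocity. Typical choices are $P(\rho)=\rho^\gamma$, $\mu(\rho)=\rho^\alpha$ with $\gamma>1$, $\alpha\in\mathbb{R}$. "Degenerate metric" means a symmetric positive semidefinite bilinear form on each $T_u\mathcal{M}$. $\frac{\delta}{\delta m}\mathcal{G}$ is the $L^2$ first variation: $\frac{d}{d\epsilon}\big|_{\epsilon=0}\mathcal{G}(\rho,m+\epsilon h)=\int_\Omega\frac{\delta}{\delta m}\mathcal{G}(\rho,m)\,h\,dx$ for all smooth $h$. *)

theory Defs
  imports "HOL-Analysis.Analysis"
begin

(* Smoothness on an open set S: all iterated directional (Frechet) derivatives exist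
   and are continuous.  It is used for functions of one variable and, jointly in (t, x),
   for space-time functions. *)

primrec Ck_on :: "nat \<Rightarrow> 'a::real_normed_vector set \<Rightarrow> ('a \<Rightarrow> 'b::real_normed_vector) \<Rightarrow> bool" where
  "Ck_on 0 S f \<longleftrightarrow> continuous_on S f"
| "Ck_on (Suc k) S f \<longleftrightarrow>
     (\<forall>x\<in>S. f differentiable (at x)) \<and>
     (\<forall>v. Ck_on k S (\<lambda>x. frechet_derivative f (at x) v))"

definition smooth_on :: "'a::real_normed_vector set \<Rightarrow> ('a \<Rightarrow> 'b::real_normed_vector) \<Rightarrow> bool" where
  "smooth_on S f \<longleftrightarrow> (\<forall>k. Ck_on k S f)"

(* The torus is R/Z: functions on it are 1-periodic functions on the real line, and
   integrals over it are integrals over {0..1}. *)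

definition torus_periodic :: "(real \<Rightarrow> real) \<Rightarrow> bool" where
  "torus_periodic f \<longleftrightarrow> (\<forall>x. f (x + 1) = f x)"

definition smooth_torus :: "(real \<Rightarrow> real) \<Rightarrow> bool" where
  "smooth_torus f \<longleftrightarrow> smooth_on UNIV f \<and> torus_periodic f"

definition torus_integral :: "(real \<Rightarrow> real) \<Rightarrow> real" where
  "torus_integral f = integral {0..1} f"

(* rho t x and m t x are density and momentum, on an open set J of times. *)

definition cns_solution ::
  "real \<Rightarrow> (real \<Rightarrow> real) \<Rightarrow> (real \<Rightarrow> real) \<Rightarrow> real set \<Rightarrow>
   (real \<Rightarrow> real \<Rightarrow> real) \<Rightarrow> (real \<Rightarrow> real \<Rightarrow> real) \<Rightarrow> bool" where
  "cns_solution \<beta> P \<mu> J \<rho> m \<longleftrightarrow>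
     smooth_on (J \<times> UNIV) (\<lambda>(t, x). \<rho> t x) \<and>
     smooth_on (J \<times> UNIV) (\<lambda>(t, x). m t x) \<and>
     (\<forall>t\<in>J. torus_periodic (\<rho> t) \<and> torus_periodic (m t)) \<and>
     (\<forall>t\<in>J. \<forall>x. \<rho> t x > 0) \<and>
     (\<forall>t\<in>J. \<forall>x. deriv (\<lambda>s. \<rho> s x) t + deriv (m t) x = 0) \<and>
     (\<forall>t\<in>J. \<forall>x.
        deriv (\<lambda>s. m s x) t + deriv (\<lambda>y. (m t y)\<^sup>2 / \<rho> t y) x + deriv (\<lambda>y. P (\<rho> t y)) x
        = \<beta> * deriv (\<lambda>y. \<mu> (\<rho> t y) * deriv (\<lambda>z. m t z / \<rho> t z) y) x)"

(* Q'' (r) = P' (r) / r on the positive half-line. *)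

definition is_P_hat :: "(real \<Rightarrow> real) \<Rightarrow> (real \<Rightarrow> real) \<Rightarrow> bool" where
  "is_P_hat P Q \<longleftrightarrow>
     (\<forall>r>0. Q differentiable (at r) \<and>
            (deriv Q has_real_derivative deriv P r / r) (at r))"

definition entropy :: "(real \<Rightarrow> real) \<Rightarrow> real \<Rightarrow> real \<Rightarrow> real" where
  "entropy Q r q = q\<^sup>2 / (2 * r) + Q r"

definition entropy_flux :: "(real \<Rightarrow> real) \<Rightarrow> real \<Rightarrow> real \<Rightarrow> real" where
  "entropy_flux Q r q = q ^ 3 / (2 * r\<^sup>2) + deriv Q r * q"

definition total_entropy :: "(real \<Rightarrow> real) \<Rightarrow> (real \<Rightarrow> real) \<Rightarrow> (real \<Rightarrow> real) \<Rightarrow> real" where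
  "total_entropy Q \<rho> m = torus_integral (\<lambda>x. entropy Q (\<rho> x) (m x))"

type_synonym fun_pair = "(real \<Rightarrow> real) \<times> (real \<Rightarrow> real)"

definition state_space :: "real \<Rightarrow> real \<Rightarrow> fun_pair set" where
  "state_space c1 c2 =
     {(\<rho>, m). smooth_torus \<rho> \<and> smooth_torus m \<and> (\<forall>x. \<rho> x > 0) \<and>
              torus_integral \<rho> = c1 \<and> torus_integral m = c2}"

(* The tangent space is the same at every point of the state space. *)

definition tangent_space :: "fun_pair set" where
  "tangent_space =
     {(\<rho>', m'). smooth_torus \<rho>' \<and> smooth_torus m' \<and>
                torus_integral \<rho>' = 0 \<and> torus_integral m' = 0}"

definition lin_comb :: "real \<Rightarrow> fun_pair \<Rightarrow> real \<Rightarrow> fun_pair \<Rightarrow> fun_pair" where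
  "lin_comb a X b Y =
     (\<lambda>x. a * fst X x + b * fst Y x, \<lambda>x. a * snd X x + b * snd Y x)"

(* Symmetric positive semidefinite bilinear form on a linear space V of pairs of functions. *)

definition degenerate_metric_on :: "fun_pair set \<Rightarrow> (fun_pair \<Rightarrow> fun_pair \<Rightarrow> real) \<Rightarrow> bool" where
  "degenerate_metric_on V B \<longleftrightarrow>
     (\<forall>X\<in>V. \<forall>Y\<in>V. B X Y = B Y X) \<and>
     (\<forall>X\<in>V. \<forall>Y\<in>V. \<forall>Z\<in>V. \<forall>a b.
        B (lin_comb a X b Y) Z = a * B X Z + b * B Y Z \<and>
        B Z (lin_comb a X b Y) = a * B Z X + b * B Z Y) \<and>
     (\<forall>X\<in>V. B X X \<ge> 0)"

definition is_potential ::
  "(real \<Rightarrow> real) \<Rightarrow> fun_pair \<Rightarrow> fun_pair \<Rightarrow> (real \<Rightarrow> real) \<Rightarrow> bool" where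
  "is_potential \<mu> u X \<psi> \<longleftrightarrow>
     smooth_torus \<psi> \<and>
     (\<forall>x. snd X x = - deriv (\<lambda>y. \<mu> (fst u y) * deriv \<psi> y) x)"

definition dissipation_form ::
  "(real \<Rightarrow> real) \<Rightarrow> fun_pair \<Rightarrow> (real \<Rightarrow> real) \<Rightarrow> (real \<Rightarrow> real) \<Rightarrow> real" where
  "dissipation_form \<mu> u \<psi>1 \<psi>2 =
     torus_integral (\<lambda>x. deriv \<psi>1 x * deriv \<psi>2 x * \<mu> (fst u x))"

(* Potentials are determined only up to constants; one is chosen here. *)

definition metric_g :: "(real \<Rightarrow> real) \<Rightarrow> fun_pair \<Rightarrow> fun_pair \<Rightarrow> fun_pair \<Rightarrow> real" where
  "metric_g \<mu> u X Y =
     dissipation_form \<mu> u (SOME \<psi>. is_potential \<mu> u X \<psi>) (SOME \<psi>. is_potential \<mu> u Y \<psi>)"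

(* w is the L2 first variation of the functional F with respect to its second argument m. *)

definition is_first_variation_m ::
  "((real \<Rightarrow> real) \<Rightarrow> (real \<Rightarrow> real) \<Rightarrow> real) \<Rightarrow> (real \<Rightarrow> real) \<Rightarrow> (real \<Rightarrow> real) \<Rightarrow>
   (real \<Rightarrow> real) \<Rightarrow> bool" where
  "is_first_variation_m F \<rho> m w \<longleftrightarrow>
     smooth_torus w \<and>
     (\<forall>h. smooth_torus h \<longrightarrow>
        ((\<lambda>\<epsilon>. F \<rho> (\<lambda>x. m x + \<epsilon> * h x))
           has_real_derivative torus_integral (\<lambda>x. w x * h x)) (at 0))"

definition first_variation_m ::
  "((real \<Rightarrow> real) \<Rightarrow> (real \<Rightarrow> real) \<Rightarrow> real) \<Rightarrow> (real \<Rightarrow> real) \<Rightarrow> (real \<Rightarrow> real) \<Rightarrow> real \<Rightarrow> real" where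
  "first_variation_m F \<rho> m = (THE w. is_first_variation_m F \<rho> m w)"

definition fisher_information ::
  "(real \<Rightarrow> real) \<Rightarrow> ((real \<Rightarrow> real) \<Rightarrow> (real \<Rightarrow> real) \<Rightarrow> real) \<Rightarrow>
   (real \<Rightarrow> real) \<Rightarrow> (real \<Rightarrow> real) \<Rightarrow> real" where
  "fisher_information \<mu> F \<rho> m =
     torus_integral (\<lambda>x. \<bar>deriv (first_variation_m F \<rho> m) x\<bar>\<^sup>2 * \<mu> (\<rho> x))"

end

theory Submission
  imports Defs
begin

text \<open>
  With velocity \<open>v = m / \<rho>\<close>, which is the first variation of the total entropy in \<open>m\<close>, the chain rule
  and the equations give the pointwise balance
  \<open>\<partial>\<^sub>t G + \<partial>\<^sub>x \<Psi> = \<beta> v \<partial>\<^sub>x (\<mu>(\<rho>) \<partial>\<^sub>x v)\<close>. For \<open>\<beta> = 0\<close> this is the entropy equality; in general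
  \<open>\<partial>\<^sub>t G + \<beta> \<mu>(\<rho>) (\<partial>\<^sub>x v)\<^sup>2\<close> is the \<open>x\<close>-derivative of a periodic function, so it has zero integral.

  On the circle the potential equation \<open>f = - (a \<psi>')'\<close> is solved by integrating twice: if \<open>M' = f\<close> then
  \<open>\<psi>' = (c - M) / a\<close>, and the constant \<open>c\<close> is fixed by requiring \<open>\<psi>'\<close> to have mean zero. Hence
  \<open>\<psi>'\<close> is unique and linear in \<open>f\<close>, and the metric is a well-defined symmetric bilinear form.
\<close>

section \<open>Smooth functions\<close>

text \<open>At a point of an open set the derivative depends only on the values in that set. The
  induction on \<open>k\<close> can therefore replace a derivative by any formula that is valid on
  \<open>S\<close> alone, which is how all closure rules below are proved.\<close>

lemma Ck_on_cong:
  assumes "open S" "\<And>x. x \<in> S \<Longrightarrow> f x = g x" "Ck_on k S f"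
  shows "Ck_on k S g"
  using assms
proof (induction k arbitrary: f g)
  case 0
  then show ?case by (simp cong: continuous_on_cong)
next
  case (Suc k)
  have *: "(g has_derivative frechet_derivative f (at x)) (at x)" if "x \<in> S" for x
  proof (rule has_derivative_transform_within_open[OF _ Suc.prems(1) that])
    show "(f has_derivative frechet_derivative f (at x)) (at x)"
      using Suc.prems(3) that by (simp flip: frechet_derivative_works)
  qed (use Suc.prems(2) in auto)
  then have eq: "frechet_derivative f (at x) v = frechet_derivative g (at x) v" if "x \<in> S" for x v
    using frechet_derivative_at that by metis
  have "Ck_on k S (\<lambda>x. frechet_derivative g (at x) v)" for v
    by (rule Suc.IH[OF Suc.prems(1) eq]) (use Suc.prems(3) in \<open>simp_all only: Ck_on.simps\<close>)
  moreover have "g differentiable (at x)" if "x \<in> S" for x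
    using *[OF that] unfolding differentiable_def by blast
  ultimately show ?case by simp
qed

lemma Ck_on_continuous_on: "Ck_on k S f \<Longrightarrow> continuous_on S f"
  by (cases k) (auto intro!: continuous_at_imp_continuous_on differentiable_imp_continuous_within)

text \<open>The successor clause of \<open>Ck_on\<close> does not list continuity of the function
  itself. Differentiability supplies it at order zero, and the induction then passes to the
  directional derivatives.\<close>

lemma Ck_on_SucD: "Ck_on (Suc k) S f \<Longrightarrow> Ck_on k S f"
proof (induction k arbitrary: f)
  case 0
  then show ?case using Ck_on_continuous_on by (metis Ck_on.simps(1))
next
  case (Suc k)
  have "Ck_on k S (\<lambda>x. frechet_derivative f (at x) v)" for v
    using Suc.prems by (intro Suc.IH) (metis Ck_on.simps(2))
  with Suc.prems show ?case by (metis Ck_on.simps(2))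
qed

lemma smooth_on_continuous_on: "smooth_on S f \<Longrightarrow> continuous_on S f"
  using Ck_on_continuous_on smooth_on_def by blast

lemma smooth_on_differentiable: "smooth_on S f \<Longrightarrow> x \<in> S \<Longrightarrow> f differentiable (at x)"
  unfolding smooth_on_def by (metis Ck_on.simps(2))

lemma smooth_on_frechet_derivative:
  "smooth_on S f \<Longrightarrow> smooth_on S (\<lambda>x. frechet_derivative f (at x) v)"
  unfolding smooth_on_def by (metis Ck_on.simps(2))

section \<open>Functions of one real variable: from directional derivatives to
  \<open>deriv\<close>\<close>

lemma frechet_derivative_real:
  fixes f :: "real \<Rightarrow> real"
  assumes "f differentiable (at x)"
  shows "frechet_derivative f (at x) v = v * deriv f x"
proof -
  have "(f has_derivative (*) (deriv f x)) (at x)"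
    using assms by (simp add: DERIV_deriv_iff_real_differentiable flip: has_field_derivative_def)
  then show ?thesis
    using frechet_derivative_at by (metis mult.commute)
qed

lemma Ck_on_cmult:
  fixes f :: "'a::real_normed_vector \<Rightarrow> real"
  assumes "open S" "Ck_on k S f"
  shows "Ck_on k S (\<lambda>x. c * f x)"
  using assms(2)
proof (induction k arbitrary: f)
  case 0
  then show ?case by (auto intro: continuous_intros)
next
  case (Suc k)
  have *: "((\<lambda>x. c * f x) has_derivative (\<lambda>v. c * frechet_derivative f (at x) v)) (at x)"
    if "x \<in> S" for x
    using Suc.prems that by (intro has_derivative_mult_right) (simp flip: frechet_derivative_works)
  then have eq: "c * frechet_derivative f (at x) v = frechet_derivative (\<lambda>x. c * f x) (at x) v"
    if "x \<in> S" for x v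
    using frechet_derivative_at that by metis
  have "Ck_on k S (\<lambda>x. frechet_derivative (\<lambda>x. c * f x) (at x) v)" for v
  proof (rule Ck_on_cong[OF assms(1) eq])
    show "Ck_on k S (\<lambda>x. c * frechet_derivative f (at x) v)"
      using Suc.prems by (intro Suc.IH) simp
  qed
  moreover have "(\<lambda>x. c * f x) differentiable (at x)" if "x \<in> S" for x
    using *[OF that] unfolding differentiable_def by blast
  ultimately show ?case by simp
qed

text \<open>On the line every direction \<open>v\<close> is a multiple of 1 and the directional
  derivative is \<open>v * deriv f x\<close>. By closure under scalar multiples, the condition on
  all directions collapses to one on \<open>deriv f\<close>.\<close>

lemma Ck_on_Suc_real:
  fixes f :: "real \<Rightarrow> real"
  assumes "open S"
  shows "Ck_on (Suc k) S f \<longleftrightarrow> (\<forall>x\<in>S. f differentiable (at x)) \<and> Ck_on k S (deriv f)"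
    (is "?L \<longleftrightarrow> ?R")
proof
  assume L: ?L
  then have d: "f differentiable (at x)" if "x \<in> S" for x
    using that by (metis Ck_on.simps(2))
  have "frechet_derivative f (at x) 1 = deriv f x" if "x \<in> S" for x
    using frechet_derivative_real[OF d[OF that], of 1] by (metis mult_1)
  moreover have "Ck_on k S (\<lambda>x. frechet_derivative f (at x) 1)"
    using L by (metis Ck_on.simps(2))
  ultimately have "Ck_on k S (deriv f)"
    by (rule Ck_on_cong[OF assms])
  with d show ?R by blast
next
  assume R: ?R
  have "v * deriv f x = frechet_derivative f (at x) v" if "x \<in> S" for x v
    using frechet_derivative_real R that by metis
  moreover have "Ck_on k S (\<lambda>x. v * deriv f x)" for v
    using R Ck_on_cmult[OF assms] by blast
  ultimately have "Ck_on k S (\<lambda>x. frechet_derivative f (at x) v)" for v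
    by (rule Ck_on_cong[OF assms])
  with R show ?L by (metis Ck_on.simps(2))
qed

lemma Ck_on_Suc_realI:
  fixes f :: "real \<Rightarrow> real"
  assumes "open S" "\<And>x. x \<in> S \<Longrightarrow> (f has_real_derivative f' x) (at x)" "Ck_on k S f'"
  shows "Ck_on (Suc k) S f"
  unfolding Ck_on_Suc_real[OF assms(1)]
proof
  show "\<forall>x\<in>S. f differentiable (at x)"
    using assms(2) by (auto simp: real_differentiable_def)
  show "Ck_on k S (deriv f)"
    by (rule Ck_on_cong[OF assms(1) _ assms(3)]) (simp add: DERIV_imp_deriv[OF assms(2)])
qed

lemma Ck_on_Suc_realD:
  fixes f :: "real \<Rightarrow> real"
  assumes "open S" "Ck_on (Suc k) S f"
  shows "Ck_on k S (deriv f)" "\<And>x. x \<in> S \<Longrightarrow> (f has_real_derivative deriv f x) (at x)"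
  using assms(2) unfolding Ck_on_Suc_real[OF assms(1)]
  by (auto simp: DERIV_deriv_iff_real_differentiable)

lemma Ck_on_const_real: "Ck_on k S (\<lambda>x::real. c::real)"
  by (induction k arbitrary: c) auto

lemma Ck_on_add_real:
  fixes f g :: "real \<Rightarrow> real"
  assumes "open S" "Ck_on k S f" "Ck_on k S g"
  shows "Ck_on k S (\<lambda>x. f x + g x)"
  using assms(2,3)
proof (induction k arbitrary: f g)
  case 0
  then show ?case by (auto intro: continuous_intros)
next
  case (Suc k)
  note D = Ck_on_Suc_realD[OF assms(1)]
  show ?case
    by (rule Ck_on_Suc_realI[OF assms(1) _ Suc.IH[OF D(1)[OF Suc.prems(1)] D(1)[OF Suc.prems(2)]]])
      (auto intro!: derivative_eq_intros D(2)[OF Suc.prems(1)] D(2)[OF Suc.prems(2)])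
qed

lemma Ck_on_mult_real:
  fixes f g :: "real \<Rightarrow> real"
  assumes "open S" "Ck_on k S f" "Ck_on k S g"
  shows "Ck_on k S (\<lambda>x. f x * g x)"
  using assms(2,3)
proof (induction k arbitrary: f g)
  case 0
  then show ?case by (auto intro: continuous_intros)
next
  case (Suc k)
  note D = Ck_on_Suc_realD[OF assms(1)]
  \<comment> \<open>The product rule mixes derivatives, which are of class \<open>k\<close>, with
    the factors themselves, which are of class \<open>Suc k\<close> and must first be lowered by one
    order.\<close>
  have "Ck_on k S (\<lambda>x. deriv f x * g x + f x * deriv g x)"
    using Suc D(1) Ck_on_SucD by (intro Ck_on_add_real[OF assms(1)]) blast+
  then show ?case
    by (rule Ck_on_Suc_realI[OF assms(1), rotated])
      (auto intro!: derivative_eq_intros D(2)[OF Suc.prems(1)] D(2)[OF Suc.prems(2)])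
qed

lemma Ck_on_compose_real:
  fixes f g :: "real \<Rightarrow> real"
  assumes "open S" "open T" "Ck_on k T f" "Ck_on k S g" "g ` S \<subseteq> T"
  shows "Ck_on k S (\<lambda>x. f (g x))"
  using assms(3,4)
proof (induction k arbitrary: f)
  case 0
  then show ?case using assms(5) by (auto intro: continuous_on_compose2)
next
  case (Suc k)
  note D = Ck_on_Suc_realD[OF assms(1) Suc.prems(2)] Ck_on_Suc_realD[OF assms(2) Suc.prems(1)]
  \<comment> \<open>The induction hypothesis is applied to the outer function
    \<open>deriv f\<close>, with the inner function \<open>g\<close> lowered by one order.\<close>
  have "Ck_on k S (\<lambda>x. deriv f (g x) * deriv g x)"
    using Suc D Ck_on_SucD by (intro Ck_on_mult_real[OF assms(1)]) blast+
  then show ?case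
    using assms(5) D(2,4)
    by (intro Ck_on_Suc_realI[OF assms(1)]) (auto intro!: DERIV_chain2[where f=f and g=g])
qed

text \<open>The derivative of the inverse is minus its own square, so class \<open>k\<close> for the
  function yields class \<open>k\<close> for its derivative, and the order climbs by itself.\<close>

lemma Ck_on_inverse_real: "Ck_on k {0<..} (inverse :: real \<Rightarrow> real)"
proof (induction k)
  case 0
  show ?case by (auto intro!: continuous_intros)
next
  case (Suc k)
  have "Ck_on k {0<..} (\<lambda>x::real. - 1 * (inverse x * inverse x))"
    using Suc by (intro Ck_on_mult_real Ck_on_const_real) auto
  then show ?case
    by (rule Ck_on_Suc_realI[rotated 2]) (auto intro!: derivative_eq_intros)
qed

section \<open>Closure properties of smooth functions of one variable\<close>

lemma smooth_on_const_real: "smooth_on S (\<lambda>x::real. c::real)"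
  by (simp add: smooth_on_def Ck_on_const_real)

lemma smooth_on_add_real:
  fixes f g :: "real \<Rightarrow> real"
  shows "open S \<Longrightarrow> smooth_on S f \<Longrightarrow> smooth_on S g \<Longrightarrow> smooth_on S (\<lambda>x. f x + g x)"
  by (simp add: smooth_on_def Ck_on_add_real)

lemma smooth_on_mult_real:
  fixes f g :: "real \<Rightarrow> real"
  shows "open S \<Longrightarrow> smooth_on S f \<Longrightarrow> smooth_on S g \<Longrightarrow> smooth_on S (\<lambda>x. f x * g x)"
  by (simp add: smooth_on_def Ck_on_mult_real)

lemma smooth_on_compose_real:
  fixes f g :: "real \<Rightarrow> real"
  shows "open S \<Longrightarrow> open T \<Longrightarrow> smooth_on T f \<Longrightarrow> smooth_on S g \<Longrightarrow> g ` S \<subseteq> T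
    \<Longrightarrow> smooth_on S (\<lambda>x. f (g x))"
  by (simp add: smooth_on_def Ck_on_compose_real)

lemma smooth_on_divide_real:
  fixes f g :: "real \<Rightarrow> real"
  assumes "open S" "smooth_on S f" "smooth_on S g" "\<And>x. x \<in> S \<Longrightarrow> g x > 0"
  shows "smooth_on S (\<lambda>x. f x / g x)"
proof -
  have "smooth_on {0<..} (inverse :: real \<Rightarrow> real)"
    by (simp add: smooth_on_def Ck_on_inverse_real)
  then have "smooth_on S (\<lambda>x. inverse (g x))"
    by (rule smooth_on_compose_real[OF assms(1) open_greaterThan _ assms(3)]) (use assms(4) in auto)
  then show ?thesis
    using smooth_on_mult_real[OF assms(1,2)] by (simp add: divide_inverse)
qed

lemma smooth_on_deriv:
  fixes f :: "real \<Rightarrow> real"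
  shows "open S \<Longrightarrow> smooth_on S f \<Longrightarrow> smooth_on S (deriv f)"
  using Ck_on_Suc_realD(1) unfolding smooth_on_def by blast

lemma smooth_on_DERIV:
  fixes f :: "real \<Rightarrow> real"
  shows "smooth_on S f \<Longrightarrow> x \<in> S \<Longrightarrow> (f has_real_derivative deriv f x) (at x)"
  using smooth_on_differentiable DERIV_deriv_iff_real_differentiable by blast

lemma smooth_on_antiderivative:
  fixes f :: "real \<Rightarrow> real"
  assumes "open S" "smooth_on S f" "\<And>x. x \<in> S \<Longrightarrow> (F has_real_derivative f x) (at x)"
  shows "smooth_on S F"
  unfolding smooth_on_def
proof
  fix k
  have "Ck_on (Suc k) S F"
    using assms Ck_on_Suc_realI smooth_on_def by blast
  then show "Ck_on k S F" by (rule Ck_on_SucD)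
qed

section \<open>Partial derivatives and slices of functions of time and space\<close>

lemma has_real_derivative_slice_fst:
  fixes F :: "real \<times> real \<Rightarrow> real"
  assumes "F differentiable (at (t, x))"
  shows "((\<lambda>s. F (s, x)) has_real_derivative frechet_derivative F (at (t, x)) (1, 0)) (at t)"
proof -
  have F: "(F has_derivative frechet_derivative F (at (t, x))) (at (t, x))"
    using assms frechet_derivative_works by blast
  have "((\<lambda>s. F (s, x)) has_derivative (\<lambda>h. frechet_derivative F (at (t, x)) (h, 0))) (at t)"
    by (rule has_derivative_compose[where f = "\<lambda>s. (s, x)" and g = F and g' = "frechet_derivative F (at (t, x))"])
      (auto intro!: derivative_eq_intros F)
  \<comment> \<open>Linearity in the direction turns the derivative along the time axis into
    multiplication by the partial derivative, the value at \<open>(1, 0)\<close>.\<close>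
  moreover have "(\<lambda>h. frechet_derivative F (at (t, x)) (h, 0)) = (*) (frechet_derivative F (at (t, x)) (1, 0))"
  proof
    fix h
    show "frechet_derivative F (at (t, x)) (h, 0) = frechet_derivative F (at (t, x)) (1, 0) * h"
      using linear_scale[OF has_derivative_linear[OF F], of h "(1, 0)"] by simp
  qed
  ultimately show ?thesis
    by (simp only: has_field_derivative_def)
qed

lemma has_real_derivative_slice_snd:
  fixes F :: "real \<times> real \<Rightarrow> real"
  assumes "F differentiable (at (t, x))"
  shows "((\<lambda>y. F (t, y)) has_real_derivative frechet_derivative F (at (t, x)) (0, 1)) (at x)"
proof -
  have F: "(F has_derivative frechet_derivative F (at (t, x))) (at (t, x))"
    using assms frechet_derivative_works by blast
  have "((\<lambda>y. F (t, y)) has_derivative (\<lambda>h. frechet_derivative F (at (t, x)) (0, h))) (at x)"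
    by (rule has_derivative_compose[where f = "\<lambda>y. (t, y)" and g = F and g' = "frechet_derivative F (at (t, x))"])
      (auto intro!: derivative_eq_intros F)
  moreover have "(\<lambda>h. frechet_derivative F (at (t, x)) (0, h)) = (*) (frechet_derivative F (at (t, x)) (0, 1))"
  proof
    fix h
    show "frechet_derivative F (at (t, x)) (0, h) = frechet_derivative F (at (t, x)) (0, 1) * h"
      using linear_scale[OF has_derivative_linear[OF F], of h "(0, 1)"] by simp
  qed
  ultimately show ?thesis
    by (simp only: has_field_derivative_def)
qed

text \<open>The derivative of a slice is the slice of the directional derivative along
  \<open>(0, 1)\<close>. The latter is again jointly smooth, so the induction runs over all
  \<open>F\<close> at once.\<close>

lemma smooth_on_slice_snd:
  fixes F :: "real \<times> real \<Rightarrow> real"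
  assumes "smooth_on (J \<times> UNIV) F" "t \<in> J"
  shows "smooth_on UNIV (\<lambda>x. F (t, x))"
proof -
  have "Ck_on k UNIV (\<lambda>x. F (t, x))" for k
    using assms(1)
  proof (induction k arbitrary: F)
    case 0
    have "continuous_on UNIV (\<lambda>x. F (t, x))"
      by (rule continuous_on_compose2[OF smooth_on_continuous_on[OF 0]])
        (use assms(2) in \<open>auto intro: continuous_on_Pair\<close>)
    then show ?case by simp
  next
    case (Suc k)
    show ?case
    proof (rule Ck_on_Suc_realI)
      show "((\<lambda>x. F (t, x)) has_real_derivative frechet_derivative F (at (t, x)) (0, 1)) (at x)" for x
        by (rule has_real_derivative_slice_snd[OF smooth_on_differentiable[OF Suc.prems]])
          (use assms(2) in simp)
      show "Ck_on k UNIV (\<lambda>x. frechet_derivative F (at (t, x)) (0, 1))"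
        using Suc.IH smooth_on_frechet_derivative[OF Suc.prems] by blast
    qed simp
  qed
  then show ?thesis by (simp add: smooth_on_def)
qed

section \<open>Functions on the torus\<close>

text \<open>By translation the same numbers qualify as derivative at \<open>x\<close> and at
  \<open>x + 1\<close>. The choice inside \<open>deriv\<close> thus agrees at both points, whether
  or not a derivative exists there.\<close>

lemma deriv_periodic:
  assumes "torus_periodic f"
  shows "torus_periodic (deriv f)"
  unfolding torus_periodic_def
proof
  fix x
  have "(\<lambda>y. f (y + 1)) = f"
    using assms by (auto simp: torus_periodic_def)
  then have "(f has_real_derivative D) (at (x + 1)) \<longleftrightarrow> (f has_real_derivative D) (at x)" for D
    using DERIV_shift[of f D x 1] by simp
  then show "deriv f (x + 1) = deriv f x"
    by (simp add: deriv_def)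
qed

lemma smooth_torus_deriv: "smooth_torus f \<Longrightarrow> smooth_torus (deriv f)"
  by (simp add: smooth_torus_def deriv_periodic smooth_on_deriv)

lemma smooth_torus_add: "smooth_torus f \<Longrightarrow> smooth_torus g \<Longrightarrow> smooth_torus (\<lambda>x. f x + g x)"
  by (simp add: smooth_torus_def smooth_on_add_real torus_periodic_def)

lemma smooth_torus_mult: "smooth_torus f \<Longrightarrow> smooth_torus g \<Longrightarrow> smooth_torus (\<lambda>x. f x * g x)"
  by (simp add: smooth_torus_def smooth_on_mult_real torus_periodic_def)

lemma smooth_torus_const: "smooth_torus (\<lambda>x. c)"
  by (simp add: smooth_torus_def smooth_on_const_real torus_periodic_def)

lemma smooth_torus_diff: "smooth_torus f \<Longrightarrow> smooth_torus g \<Longrightarrow> smooth_torus (\<lambda>x. f x - g x)"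
  using smooth_torus_add[of f, OF _ smooth_torus_mult[OF smooth_torus_const[of "-1"], of g]] by simp

lemma smooth_torus_divide:
  "smooth_torus f \<Longrightarrow> smooth_torus g \<Longrightarrow> (\<And>x. g x > 0) \<Longrightarrow> smooth_torus (\<lambda>x. f x / g x)"
  by (simp add: smooth_torus_def smooth_on_divide_real torus_periodic_def)

lemma smooth_torus_compose:
  assumes "smooth_on {0<..} f" "smooth_torus g" "\<And>x. g x > 0"
  shows "smooth_torus (\<lambda>x. f (g x))"
  using assms smooth_on_compose_real[OF open_UNIV open_greaterThan assms(1), of g]
  by (auto simp: smooth_torus_def torus_periodic_def)

lemma smooth_torus_DERIV: "smooth_torus f \<Longrightarrow> (f has_real_derivative deriv f x) (at x)"
  unfolding smooth_torus_def using smooth_on_DERIV[of UNIV f x] by blast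

lemma smooth_torus_continuous_on: "smooth_torus f \<Longrightarrow> continuous_on S f"
  unfolding smooth_torus_def by (metis smooth_on_continuous_on continuous_on_subset subset_UNIV)

lemma smooth_torus_integrable: "smooth_torus f \<Longrightarrow> f integrable_on {0..1}"
  by (simp add: integrable_continuous_real smooth_torus_continuous_on)

section \<open>Integration over the circle\<close>

lemma torus_integral_add:
  "smooth_torus f \<Longrightarrow> smooth_torus g
    \<Longrightarrow> torus_integral (\<lambda>x. f x + g x) = torus_integral f + torus_integral g"
  by (simp add: torus_integral_def integral_add smooth_torus_integrable)

lemma torus_integral_diff:
  "smooth_torus f \<Longrightarrow> smooth_torus g
    \<Longrightarrow> torus_integral (\<lambda>x. f x - g x) = torus_integral f - torus_integral g"
  by (simp add: torus_integral_def integral_diff smooth_torus_integrable)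

lemma torus_integral_cmult: "torus_integral (\<lambda>x. c * f x) = c * torus_integral f"
  by (simp add: torus_integral_def)

lemma torus_integral_nonneg:
  "smooth_torus f \<Longrightarrow> (\<And>x. f x \<ge> 0) \<Longrightarrow> torus_integral f \<ge> 0"
  by (simp add: torus_integral_def integral_nonneg smooth_torus_integrable)

lemma torus_integral_derivative:
  assumes "\<And>x. (F has_real_derivative f x) (at x)"
  shows "torus_integral f = F 1 - F 0"
proof -
  have "(f has_integral F 1 - F 0) {0..1}"
    using assms
    by (intro fundamental_theorem_of_calculus)
      (auto simp: has_real_derivative_iff_has_vector_derivative intro: has_vector_derivative_at_within)
  then show ?thesis
    by (simp add: torus_integral_def integral_unique)
qed

lemma torus_periodic_integer_shift:
  assumes "torus_periodic f"
  shows "f (x + of_int n) = f x"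
proof (induction n rule: int_induct[of _ 0])
  case base
  then show ?case by simp
next
  case (step1 i)
  then show ?case using assms by (simp add: torus_periodic_def add.assoc[symmetric])
next
  case (step2 i)
  then show ?case
    using assms[unfolded torus_periodic_def, rule_format, of "x + of_int i - 1"]
    by (simp add: algebra_simps)
qed

text \<open>A continuous nonnegative function with zero integral vanishes on the unit interval;
  periodicity, through the fractional part, carries this to the whole line.\<close>

lemma torus_integral_eq_0_imp:
  assumes "smooth_torus f" "\<And>x. f x \<ge> 0" "torus_integral f = 0"
  shows "f x = 0"
proof -
  have "\<forall>y\<in>{0..1}. f y = 0"
    using assms integral_eq_0_iff[of 0 1 f]
    by (simp add: torus_integral_def smooth_torus_continuous_on)
  then have "f (frac x) = 0"
    by (simp add: frac_lt_1 less_imp_le)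
  then show ?thesis
    using torus_periodic_integer_shift[of f "frac x" "\<lfloor>x\<rfloor>"] assms(1)
    by (simp add: smooth_torus_def frac_def)
qed

lemma torus_integral_pos:
  assumes "smooth_torus f" "\<And>x. f x > 0"
  shows "torus_integral f > 0"
  using torus_integral_nonneg[OF assms(1)] torus_integral_eq_0_imp[OF assms(1), of 0] assms(2)
  by (metis less_eq_real_def less_irrefl)

text \<open>An antiderivative \<open>F\<close> on the line descends to the circle exactly when
  \<open>f\<close> has mean zero: the increment \<open>F (x + 1) - F x\<close> has zero derivative,
  and its constant value is the integral of \<open>f\<close> over one period.\<close>

lemma has_torus_antiderivative:
  assumes "smooth_torus f" "torus_integral f = 0"
  obtains F where "smooth_torus F" "\<And>x. (F has_real_derivative f x) (at x)"
proof -
  have "isCont f x" for x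
    using smooth_torus_continuous_on[OF assms(1), of UNIV] by (simp add: continuous_on_eq_continuous_at)
  then obtain F where F: "(F has_real_derivative f x) (at x)" for x
    using einterval_antiderivative[of "-\<infinity>" "\<infinity>" f]
    by (auto simp: has_real_derivative_iff_has_vector_derivative)
  have "((\<lambda>x. F (x + 1) - F x) has_real_derivative 0) (at x)" for x
  proof -
    have "(F has_real_derivative f x) (at (x + 1))"
      using F[of "x + 1"] assms(1) by (simp add: smooth_torus_def torus_periodic_def)
    then have "((\<lambda>x. F (x + 1)) has_real_derivative f x) (at x)"
      by (simp only: DERIV_shift)
    from DERIV_diff[OF this F] show ?thesis by simp
  qed
  then have "F (x + 1) - F x = F (0 + 1) - F 0" for x
    by (rule DERIV_isconst_all[rule_format])
  moreover have "F 1 - F 0 = 0"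
    using torus_integral_derivative[OF F] assms(2) by simp
  ultimately have "torus_periodic F"
    by (auto simp: torus_periodic_def)
  moreover have "smooth_on UNIV F"
    using smooth_on_antiderivative[of UNIV f F] assms(1) F by (auto simp: smooth_torus_def)
  ultimately show ?thesis
    using that F by (simp add: smooth_torus_def)
qed

section \<open>Potentials and the degenerate metric\<close>

lemma ex_potential:
  assumes "smooth_torus a" "\<And>x. a x > 0" "smooth_torus f" "torus_integral f = 0"
  obtains \<psi> where "smooth_torus \<psi>" "\<And>x. f x = - deriv (\<lambda>y. a y * deriv \<psi> y) x"
proof -
  obtain M where M: "smooth_torus M" "\<And>x. (M has_real_derivative f x) (at x)"
    using has_torus_antiderivative assms(3,4) by blast
  have Ma: "smooth_torus (\<lambda>x. M x / a x)" and a1: "smooth_torus (\<lambda>x. 1 / a x)"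
    using assms(1,2) M(1) by (auto intro: smooth_torus_divide smooth_torus_const)
  \<comment> \<open>This is the solution of \<open>torus_integral w = 0\<close>, a linear equation
    in \<open>c\<close> whose coefficient, the integral of \<open>1 / a\<close>, is positive. Mean
    zero of \<open>f\<close> made \<open>M\<close> periodic; mean zero of \<open>w\<close> will make
    \<open>\<psi>\<close> periodic.\<close>
  define c where "c = torus_integral (\<lambda>x. M x / a x) / torus_integral (\<lambda>x. 1 / a x)"
  define w where "w = (\<lambda>x. c * (1 / a x) - M x / a x)"
  have w: "smooth_torus w"
    unfolding w_def by (intro smooth_torus_diff smooth_torus_mult smooth_torus_const Ma a1)
  have "torus_integral (\<lambda>x. 1 / a x) > 0"
    using a1 assms(2) by (intro torus_integral_pos) auto
  moreover have "torus_integral w = c * torus_integral (\<lambda>x. 1 / a x) - torus_integral (\<lambda>x. M x / a x)"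
    unfolding w_def torus_integral_cmult[symmetric]
    by (intro torus_integral_diff smooth_torus_mult smooth_torus_const Ma a1)
  ultimately have "torus_integral w = 0"
    by (simp add: c_def)
  then obtain \<psi> where \<psi>: "smooth_torus \<psi>" "\<And>x. (\<psi> has_real_derivative w x) (at x)"
    using has_torus_antiderivative w by blast
  have "a y * deriv \<psi> y = c - M y" for y
    using DERIV_imp_deriv[OF \<psi>(2), of y] assms(2)[of y] by (simp add: w_def field_simps)
  then have "deriv (\<lambda>y. a y * deriv \<psi> y) x = - f x" for x
    by (auto intro!: DERIV_imp_deriv derivative_eq_intros M(2))
  with \<psi>(1) that show ?thesis by simp
qed

text \<open>The difference of the two fluxes is a constant \<open>c\<close>, so the derivatives
  differ by \<open>c / a\<close>. A periodic function has a derivative of mean zero, and since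
  \<open>1 / a\<close> has positive integral, \<open>c\<close> must vanish.\<close>

lemma deriv_potential_unique:
  assumes a: "smooth_torus a" "\<And>x. a x > 0" and "smooth_torus \<psi>" "smooth_torus \<phi>"
    and eq: "\<And>x. deriv (\<lambda>y. a y * deriv \<psi> y) x = deriv (\<lambda>y. a y * deriv \<phi> y) x"
  shows "deriv \<psi> = deriv \<phi>"
proof -
  have "((\<lambda>y. a y * deriv \<psi> y - a y * deriv \<phi> y) has_real_derivative 0) (at x)" for x
  proof -
    have "((\<lambda>y. a y * deriv \<psi> y - a y * deriv \<phi> y) has_real_derivative
      deriv (\<lambda>y. a y * deriv \<psi> y) x - deriv (\<lambda>y. a y * deriv \<phi> y) x) (at x)"
      by (intro DERIV_diff smooth_torus_DERIV smooth_torus_mult smooth_torus_deriv assms)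
    then show ?thesis by (simp add: eq)
  qed
  then have const: "a x * deriv \<psi> x - a x * deriv \<phi> x = a 0 * deriv \<psi> 0 - a 0 * deriv \<phi> 0" for x
    by (rule DERIV_isconst_all[rule_format])
  define c where "c = a 0 * deriv \<psi> 0 - a 0 * deriv \<phi> 0"
  have d: "deriv \<psi> x - deriv \<phi> x = c * (1 / a x)" for x
    using const[of x] a(2)[of x] by (simp add: c_def field_simps)
  have "torus_integral (\<lambda>x. deriv \<psi> x - deriv \<phi> x) = (\<psi> 1 - \<phi> 1) - (\<psi> 0 - \<phi> 0)"
    by (intro torus_integral_derivative DERIV_diff smooth_torus_DERIV assms)
  moreover have "\<psi> 1 = \<psi> 0" "\<phi> 1 = \<phi> 0"
    using assms(3,4) by (metis smooth_torus_def torus_periodic_def add_0)+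
  ultimately have "c * torus_integral (\<lambda>x. 1 / a x) = 0"
    by (simp add: d torus_integral_cmult[symmetric])
  moreover have "torus_integral (\<lambda>x. 1 / a x) > 0"
    using a by (intro torus_integral_pos smooth_torus_divide smooth_torus_const) auto
  ultimately have "c = 0" by simp
  with d show ?thesis by (auto simp: fun_eq_iff)
qed

text \<open>The form sees potentials only through their derivatives, which are unique. Hence the
  potentials picked by the choice operator may be replaced by any others.\<close>

lemma metric_g_eq:
  assumes "smooth_torus (\<lambda>x. \<mu> (fst u x))" "\<And>x. \<mu> (fst u x) > 0"
    and "is_potential \<mu> u X \<psi>" "is_potential \<mu> u Y \<phi>"
  shows "metric_g \<mu> u X Y = torus_integral (\<lambda>x. deriv \<psi> x * deriv \<phi> x * \<mu> (fst u x))"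
proof -
  have pot: "smooth_torus \<theta>" "deriv (\<lambda>y. \<mu> (fst u y) * deriv \<theta> y) x = - snd Z x"
    if "is_potential \<mu> u Z \<theta>" for Z \<theta> x
    using that by (simp_all add: is_potential_def)
  have *: "deriv (SOME \<psi>. is_potential \<mu> u Z \<psi>) = deriv \<theta>" if "is_potential \<mu> u Z \<theta>" for Z \<theta>
  proof -
    have some: "is_potential \<mu> u Z (SOME \<psi>. is_potential \<mu> u Z \<psi>)"
      using someI[of "is_potential \<mu> u Z", OF that] .
    show ?thesis
      by (rule deriv_potential_unique[OF assms(1,2) pot(1)[OF some] pot(1)[OF that]])
        (simp only: pot(2)[OF some] pot(2)[OF that])
  qed
  show ?thesis
    by (simp only: metric_g_def dissipation_form_def *[OF assms(3)] *[OF assms(4)])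
qed

text \<open>The potentials picked by the choice operator need not depend linearly on the tangent
  vector. A linear combination of potentials is still an admissible potential, which suffices for
  bilinearity because any potential computes the metric.\<close>

lemma is_potential_lin_comb:
  assumes a: "smooth_torus (\<lambda>x. \<mu> (fst u x))"
    and X: "is_potential \<mu> u X \<psi>" and Y: "is_potential \<mu> u Y \<phi>"
  shows "is_potential \<mu> u (lin_comb a X b Y) (\<lambda>x. a * \<psi> x + b * \<phi> x)"
    and "deriv (\<lambda>x. a * \<psi> x + b * \<phi> x) = (\<lambda>x. a * deriv \<psi> x + b * deriv \<phi> x)"
proof -
  have s: "smooth_torus \<psi>" "smooth_torus \<phi>"
    using X Y by (auto simp: is_potential_def)
  show d: "deriv (\<lambda>x. a * \<psi> x + b * \<phi> x) = (\<lambda>x. a * deriv \<psi> x + b * deriv \<phi> x)"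
    by (intro ext DERIV_imp_deriv DERIV_add DERIV_cmult smooth_torus_DERIV s)
  have "((\<lambda>y. a * (\<mu> (fst u y) * deriv \<psi> y) + b * (\<mu> (fst u y) * deriv \<phi> y)) has_real_derivative
      a * deriv (\<lambda>y. \<mu> (fst u y) * deriv \<psi> y) x + b * deriv (\<lambda>y. \<mu> (fst u y) * deriv \<phi> y) x) (at x)" for x
    by (intro DERIV_add DERIV_cmult smooth_torus_DERIV smooth_torus_mult smooth_torus_deriv assms s)
  then have "deriv (\<lambda>y. \<mu> (fst u y) * (a * deriv \<psi> y + b * deriv \<phi> y)) x =
      a * deriv (\<lambda>y. \<mu> (fst u y) * deriv \<psi> y) x + b * deriv (\<lambda>y. \<mu> (fst u y) * deriv \<phi> y) x" for x
    by (intro DERIV_imp_deriv) (simp add: algebra_simps)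
  moreover have "smooth_torus (\<lambda>x. a * \<psi> x + b * \<phi> x)"
    by (intro smooth_torus_add smooth_torus_mult smooth_torus_const s)
  ultimately show "is_potential \<mu> u (lin_comb a X b Y) (\<lambda>x. a * \<psi> x + b * \<phi> x)"
    using X Y by (simp add: is_potential_def lin_comb_def d)
qed

lemma degenerate_metric_on_metric_g:
  assumes a: "smooth_torus (\<lambda>x. \<mu> (fst u x))" "\<And>x. \<mu> (fst u x) > 0"
    and ex: "\<And>X. X \<in> V \<Longrightarrow> \<exists>\<psi>. is_potential \<mu> u X \<psi>"
  shows "degenerate_metric_on V (metric_g \<mu> u)"
proof -
  note eq = metric_g_eq[OF a]
  \<comment> \<open>Symmetry is that of the integrand, whatever functions the choice operator
    returns; linearity in the second slot will follow from it and linearity in the first.\<close>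
  have sym: "metric_g \<mu> u X Y = metric_g \<mu> u Y X" for X Y
    unfolding metric_g_def dissipation_form_def
    by (subst mult.commute[of "deriv (SOME \<psi>. is_potential \<mu> u X \<psi>) _"]) (rule refl)
  have lin: "metric_g \<mu> u (lin_comb c X d Y) Z = c * metric_g \<mu> u X Z + d * metric_g \<mu> u Y Z"
    if V: "X \<in> V" "Y \<in> V" "Z \<in> V" for X Y Z c d
  proof -
    obtain \<psi> where \<psi>: "is_potential \<mu> u X \<psi>" using ex[OF V(1)] ..
    obtain \<phi> where \<phi>: "is_potential \<mu> u Y \<phi>" using ex[OF V(2)] ..
    obtain \<theta> where \<theta>: "is_potential \<mu> u Z \<theta>" using ex[OF V(3)] ..
    note p = \<psi> \<phi> \<theta>
    have s: "smooth_torus \<psi>" "smooth_torus \<phi>" "smooth_torus \<theta>"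
      using p by (auto simp: is_potential_def)
    note l = is_potential_lin_comb[OF a(1) p(1,2), of c d]
    have "metric_g \<mu> u (lin_comb c X d Y) Z =
        torus_integral (\<lambda>x. c * (deriv \<psi> x * deriv \<theta> x * \<mu> (fst u x))
          + d * (deriv \<phi> x * deriv \<theta> x * \<mu> (fst u x)))"
      by (simp add: eq[OF l(1) p(3)] l(2) algebra_simps)
    also have "\<dots> = c * metric_g \<mu> u X Z + d * metric_g \<mu> u Y Z"
      unfolding eq[OF p(1,3)] eq[OF p(2,3)] torus_integral_cmult[symmetric]
      by (intro torus_integral_add smooth_torus_mult smooth_torus_const smooth_torus_deriv s a)
    finally show ?thesis .
  qed
  have "metric_g \<mu> u X X \<ge> 0" if X: "X \<in> V" for X
  proof -
    obtain \<psi> where p: "is_potential \<mu> u X \<psi>"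
      using ex[OF X] ..
    then have s: "smooth_torus \<psi>" by (simp add: is_potential_def)
    show ?thesis
      unfolding eq[OF p p]
    proof (rule torus_integral_nonneg)
      show "smooth_torus (\<lambda>x. deriv \<psi> x * deriv \<psi> x * \<mu> (fst u x))"
        by (intro smooth_torus_mult smooth_torus_deriv s a)
      show "deriv \<psi> x * deriv \<psi> x * \<mu> (fst u x) \<ge> 0" for x
        using a(2)[of x] by (intro mult_nonneg_nonneg[OF zero_le_square]) simp
    qed
  qed
  moreover have "metric_g \<mu> u Z (lin_comb c X d Y) = c * metric_g \<mu> u Z X + d * metric_g \<mu> u Z Y"
    if "X \<in> V" "Y \<in> V" "Z \<in> V" for X Y Z c d
    using lin[OF that, of c d] by (simp only: sym[of Z])
  ultimately show ?thesis
    unfolding degenerate_metric_on_def using sym lin by (intro conjI ballI allI)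
qed

section \<open>First variation of the entropy\<close>

lemma is_P_hat_DERIV:
  assumes "is_P_hat P Q" "r > 0"
  shows "(Q has_real_derivative deriv Q r) (at r)"
    and "(deriv Q has_real_derivative deriv P r / r) (at r)"
  using assms unfolding is_P_hat_def DERIV_deriv_iff_real_differentiable by blast+

lemma is_P_hat_continuous_on:
  assumes "is_P_hat P Q"
  shows "continuous_on {0<..} Q" "continuous_on {0<..} (deriv Q)"
  using is_P_hat_DERIV[OF assms]
  by (intro continuous_at_imp_continuous_on ballI; metis DERIV_isCont greaterThan_iff)+

text \<open>The function P'(r) / r is continuous on the half-line, so it can be integrated twice
  there.\<close>

lemma ex_P_hat:
  assumes "smooth_on {0<..} P"
  shows "\<exists>Q. is_P_hat P Q"
proof -
  have anti: "\<exists>F. \<forall>r>0. (F has_real_derivative f r) (at r)"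
    if "continuous_on {0<..} f" for f :: "real \<Rightarrow> real"
  proof -
    have "isCont f r" if "r > 0" for r
      using \<open>continuous_on {0<..} f\<close> that by (simp add: continuous_on_eq_continuous_at)
    then show ?thesis
      using einterval_antiderivative[of 0 "\<infinity>" f]
      by (auto simp: has_real_derivative_iff_has_vector_derivative)
  qed
  have "continuous_on {0<..} (\<lambda>r. deriv P r / r)"
    using smooth_on_continuous_on[OF smooth_on_deriv[OF open_greaterThan assms]]
    by (intro continuous_on_divide continuous_on_id) auto
  then obtain q where q: "\<And>r. r > 0 \<Longrightarrow> (q has_real_derivative deriv P r / r) (at r)"
    using anti by blast
  have "continuous_on {0<..} q"
    by (intro continuous_at_imp_continuous_on ballI) (metis DERIV_isCont greaterThan_iff q)
  then obtain Q where Q: "\<And>r. r > 0 \<Longrightarrow> (Q has_real_derivative q r) (at r)"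
    using anti by blast
  \<comment> \<open>The first antiderivative \<open>q\<close> agrees with \<open>deriv Q\<close>
    only for positive arguments, so its derivative is transferred within that open set.\<close>
  have "(deriv Q has_real_derivative deriv P r / r) (at r)" if "r > 0" for r
  proof (rule has_field_derivative_transform_within_open)
    show "(q has_real_derivative deriv P r / r) (at r)" "r \<in> {0<..}"
      using q that by auto
    show "q s = deriv Q s" if "s \<in> {0<..}" for s
      using DERIV_imp_deriv[OF Q] that by simp
  qed simp
  then show ?thesis
    using Q unfolding is_P_hat_def real_differentiable_def by blast
qed

text \<open>For fixed density the entropy is quadratic in the momentum. The perturbed functional is
  therefore an exact quadratic polynomial in \<open>\<epsilon>\<close>, whose linear coefficient is
  the claimed pairing.\<close>

lemma is_first_variation_m_entropy:
  assumes Q: "is_P_hat P Q" and \<rho>: "smooth_torus \<rho>" "\<And>x. \<rho> x > 0" and m: "smooth_torus m"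
  shows "is_first_variation_m (total_entropy Q) \<rho> m (\<lambda>x. m x / \<rho> x)"
  unfolding is_first_variation_m_def
proof (intro conjI allI impI)
  show "smooth_torus (\<lambda>x. m x / \<rho> x)"
    using assms by (intro smooth_torus_divide)
  fix h
  assume h: "smooth_torus h"
  have c: "continuous_on {0..1} (\<lambda>x. Q (\<rho> x))"
    using \<rho> by (intro continuous_on_compose2[OF is_P_hat_continuous_on(1)[OF Q]] smooth_torus_continuous_on) auto
  note sc = smooth_torus_continuous_on[OF \<rho>(1)] smooth_torus_continuous_on[OF m] smooth_torus_continuous_on[OF h]
  have pos: "2 * \<rho> x \<noteq> 0" "\<rho> x \<noteq> 0" for x
    using \<rho>(2)[of x] by auto
  define A where "A = (\<lambda>x. (m x)\<^sup>2 / (2 * \<rho> x) + Q (\<rho> x))"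
  define B where "B = (\<lambda>x. m x / \<rho> x * h x)"
  define C where "C = (\<lambda>x. (h x)\<^sup>2 / (2 * \<rho> x))"
  have int: "A integrable_on {0..1}" "B integrable_on {0..1}" "C integrable_on {0..1}"
    unfolding A_def B_def C_def
    by (intro integrable_continuous_real continuous_intros sc c ballI pos)+
  have "entropy Q (\<rho> x) (m x + \<epsilon> * h x) = A x + \<epsilon> * B x + \<epsilon>\<^sup>2 * C x" for \<epsilon> x
    using \<rho>(2)[of x] by (simp add: entropy_def A_def B_def C_def field_simps power2_eq_square)
  then have "total_entropy Q \<rho> (\<lambda>x. m x + \<epsilon> * h x) = integral {0..1} A + \<epsilon> * integral {0..1} B + \<epsilon>\<^sup>2 * integral {0..1} C"
    for \<epsilon>
    using int integrable_on_mult_right[OF int(2), of \<epsilon>] integrable_on_mult_right[OF int(3), of "\<epsilon>\<^sup>2"]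
    by (simp add: total_entropy_def torus_integral_def integral_add integrable_add)
  moreover have "((\<lambda>\<epsilon>. integral {0..1} A + \<epsilon> * integral {0..1} B + \<epsilon>\<^sup>2 * integral {0..1} C)
      has_real_derivative integral {0..1} B) (at 0)"
    by (auto intro!: derivative_eq_intros)
  ultimately show "((\<lambda>\<epsilon>. total_entropy Q \<rho> (\<lambda>x. m x + \<epsilon> * h x)) has_real_derivative
      torus_integral (\<lambda>x. m x / \<rho> x * h x)) (at 0)"
    by (simp add: torus_integral_def B_def)
qed

text \<open>Testing both variations against \<open>h = v - w\<close> shows that the square of
  \<open>v - w\<close> has zero integral. This justifies the definite description in
  \<open>first_variation_m\<close>.\<close>

lemma is_first_variation_m_unique:
  assumes "is_first_variation_m F \<rho> m v" "is_first_variation_m F \<rho> m w"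
  shows "v = w"
proof
  fix x
  have s: "smooth_torus v" "smooth_torus w"
    using assms by (auto simp: is_first_variation_m_def)
  then have h: "smooth_torus (\<lambda>x. v x - w x)"
    by (rule smooth_torus_diff)
  have "torus_integral (\<lambda>x. v x * (v x - w x)) = torus_integral (\<lambda>x. w x * (v x - w x))"
    using assms h unfolding is_first_variation_m_def by (blast intro: DERIV_unique)
  moreover have "torus_integral (\<lambda>x. v x * (v x - w x) - w x * (v x - w x)) =
      torus_integral (\<lambda>x. v x * (v x - w x)) - torus_integral (\<lambda>x. w x * (v x - w x))"
    by (intro torus_integral_diff smooth_torus_mult s h)
  ultimately have "torus_integral (\<lambda>x. (v x - w x) * (v x - w x)) = 0"
    by (simp add: left_diff_distrib)
  then have "(v x - w x) * (v x - w x) = 0"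
    by (rule torus_integral_eq_0_imp[OF smooth_torus_mult[OF h h], rotated]) simp
  then show "v x = w x" by simp
qed

lemma first_variation_m_entropy:
  assumes "is_P_hat P Q" "smooth_torus \<rho>" "\<And>x. \<rho> x > 0" "smooth_torus m"
  shows "first_variation_m (total_entropy Q) \<rho> m = (\<lambda>x. m x / \<rho> x)"
  unfolding first_variation_m_def
  using is_first_variation_m_entropy[OF assms] is_first_variation_m_unique
  by (intro the_equality) blast+

lemma fisher_information_entropy:
  assumes "is_P_hat P Q" "smooth_torus \<rho>" "\<And>x. \<rho> x > 0" "smooth_torus m"
  shows "fisher_information \<mu> (total_entropy Q) \<rho> m =
    torus_integral (\<lambda>x. \<bar>deriv (\<lambda>y. m y / \<rho> y) x\<bar>\<^sup>2 * \<mu> (\<rho> x))"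
  by (simp only: fisher_information_def first_variation_m_entropy[OF assms])

section \<open>Entropy balance\<close>

lemma entropy_DERIV:
  assumes "is_P_hat P Q" "f x > 0"
    and "(f has_real_derivative f') (at x)" "(g has_real_derivative g') (at x)"
  shows "((\<lambda>x. entropy Q (f x) (g x)) has_real_derivative
    g x * g' / f x - (g x)\<^sup>2 * f' / (2 * (f x)\<^sup>2) + deriv Q (f x) * f') (at x)"
proof -
  have "((\<lambda>x. Q (f x)) has_real_derivative deriv Q (f x) * f') (at x)"
    using DERIV_chain2[OF is_P_hat_DERIV(1)[OF assms(1,2)] assms(3)] .
  moreover have "((\<lambda>x. (g x)\<^sup>2 / (2 * f x)) has_real_derivative
      g x * g' / f x - (g x)\<^sup>2 * f' / (2 * (f x)\<^sup>2)) (at x)"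
    using assms(2) by (auto intro!: derivative_eq_intros assms(3,4) simp: field_simps power2_eq_square)
  ultimately show ?thesis
    unfolding entropy_def by (auto intro: DERIV_add simp: add.commute)
qed

text \<open>Applied along space at a fixed time, while \<open>entropy_DERIV\<close> is applied along
  time at a fixed point. The factor \<open>deriv P (f x) / f x\<close> is the second derivative of
  \<open>Q\<close>.\<close>

lemma entropy_flux_DERIV:
  assumes "is_P_hat P Q" "f x > 0"
    and "(f has_real_derivative f') (at x)" "(g has_real_derivative g') (at x)"
  shows "((\<lambda>x. entropy_flux Q (f x) (g x)) has_real_derivative
    3 * (g x)\<^sup>2 * g' / (2 * (f x)\<^sup>2) - g x ^ 3 * f' / f x ^ 3
    + (deriv P (f x) / f x * f' * g x + deriv Q (f x) * g')) (at x)"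
proof -
  have "((\<lambda>x. deriv Q (f x)) has_real_derivative deriv P (f x) / f x * f') (at x)"
    using DERIV_chain2[OF is_P_hat_DERIV(2)[OF assms(1,2)] assms(3)] .
  from DERIV_mult[OF this assms(4)]
  have "((\<lambda>x. deriv Q (f x) * g x) has_real_derivative
      deriv P (f x) / f x * f' * g x + deriv Q (f x) * g') (at x)"
    by (simp add: algebra_simps)
  moreover have "((\<lambda>x. g x ^ 3 / (2 * (f x)\<^sup>2)) has_real_derivative
      3 * (g x)\<^sup>2 * g' / (2 * (f x)\<^sup>2) - g x ^ 3 * f' / f x ^ 3) (at x)"
    using assms(2)
    by (auto intro!: derivative_eq_intros assms(3,4) simp: field_simps power2_eq_square power3_eq_cube)
  ultimately show ?thesis
    unfolding entropy_flux_def by (rule DERIV_add[rotated])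
qed

text \<open>Here \<open>r\<close> and \<open>q\<close> are density and momentum, \<open>rt\<close>,
  \<open>qt\<close>, \<open>rx\<close>, \<open>qx\<close> their partial derivatives,
  \<open>p\<close> and \<open>s\<close> the values of P' and Q' at \<open>r\<close>, and
  \<open>d\<close> the viscous term. Continuity cancels the terms in \<open>s\<close>; what remains
  is the momentum equation multiplied by the velocity \<open>q / r\<close>.\<close>

lemma entropy_balance_algebra:
  fixes r q :: real
  assumes r: "r > 0" and "rt + qx = 0"
    and qt: "qt + (2 * q * qx / r - q\<^sup>2 * rx / r\<^sup>2) + p * rx = d"
  shows "(q * qt / r - q\<^sup>2 * rt / (2 * r\<^sup>2) + s * rt)
    + (3 * q\<^sup>2 * qx / (2 * r\<^sup>2) - q ^ 3 * rx / r ^ 3 + (p / r * rx * q + s * qx)) = q / r * d"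
proof -
  have rt: "rt = - qx" using assms(2) by simp
  show ?thesis
    unfolding qt[symmetric] rt using r
    by (simp add: field_simps power2_eq_square power3_eq_cube)
qed

section \<open>Entropy balance and dissipation along solutions\<close>

lemma cns_solution_slice:
  assumes "cns_solution \<beta> P \<mu> J \<rho> m" "t \<in> J"
  shows "smooth_torus (\<rho> t)" "smooth_torus (m t)" "\<And>x. \<rho> t x > 0"
proof -
  have s: "smooth_on (J \<times> UNIV) (\<lambda>(t, x). \<rho> t x)" "smooth_on (J \<times> UNIV) (\<lambda>(t, x). m t x)"
    using assms by (auto simp: cns_solution_def)
  show "smooth_torus (\<rho> t)" "smooth_torus (m t)" "\<And>x. \<rho> t x > 0"
    using assms smooth_on_slice_snd[OF s(1) assms(2)] smooth_on_slice_snd[OF s(2) assms(2)]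
    by (auto simp: cns_solution_def smooth_torus_def)
qed

text \<open>Names the time derivatives as jointly continuous functions, the form required for
  differentiation under the integral sign.\<close>

lemma cns_solution_time_derivative:
  assumes "cns_solution \<beta> P \<mu> J \<rho> m"
  obtains \<rho>t mt where
    "continuous_on (J \<times> UNIV) (\<lambda>(t, x). \<rho>t t x)" "continuous_on (J \<times> UNIV) (\<lambda>(t, x). mt t x)"
    "\<And>t x. t \<in> J \<Longrightarrow> ((\<lambda>s. \<rho> s x) has_real_derivative \<rho>t t x) (at t)"
    "\<And>t x. t \<in> J \<Longrightarrow> ((\<lambda>s. m s x) has_real_derivative mt t x) (at t)"
proof -
  have s: "smooth_on (J \<times> UNIV) (\<lambda>(t, x). \<rho> t x)" "smooth_on (J \<times> UNIV) (\<lambda>(t, x). m t x)"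
    using assms by (auto simp: cns_solution_def)
  have cont: "continuous_on (J \<times> UNIV) (\<lambda>(t, x). frechet_derivative F (at (t, x)) (1, 0))"
    if "smooth_on (J \<times> UNIV) F" for F :: "real \<times> real \<Rightarrow> real"
    using smooth_on_continuous_on[OF smooth_on_frechet_derivative[OF that], of "(1, 0)"]
    by (simp add: case_prod_unfold)
  have der: "((\<lambda>s. F (s, x)) has_real_derivative frechet_derivative F (at (t, x)) (1, 0)) (at t)"
    if "smooth_on (J \<times> UNIV) F" "t \<in> J" for F :: "real \<times> real \<Rightarrow> real" and t x
    by (rule has_real_derivative_slice_fst[OF smooth_on_differentiable[OF that(1)]]) (use that in simp)
  show ?thesis
    using that[OF cont[OF s(1)] cont[OF s(2)]] der[OF s(1)] der[OF s(2)] by simp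
qed

text \<open>Stated for every \<open>\<beta>\<close>, so that it yields both the inviscid entropy
  relation and, after integration in space, the dissipation identity.\<close>

lemma cns_entropy_balance:
  assumes Q: "is_P_hat P Q" and P: "smooth_on {0<..} P"
    and sol: "cns_solution \<beta> P \<mu> J \<rho> m" and t: "t \<in> J"
    and \<rho>t: "((\<lambda>s. \<rho> s x) has_real_derivative \<rho>t) (at t)"
    and mt: "((\<lambda>s. m s x) has_real_derivative mt) (at t)"
  shows "deriv (\<lambda>s. entropy Q (\<rho> s x) (m s x)) t
    + deriv (\<lambda>y. entropy_flux Q (\<rho> t y) (m t y)) x
    = m t x / \<rho> t x * (\<beta> * deriv (\<lambda>y. \<mu> (\<rho> t y) * deriv (\<lambda>z. m t z / \<rho> t z) y) x)"
proof -
  note sl = cns_solution_slice[OF sol t]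
  note dx = smooth_torus_DERIV[OF sl(1), of x] smooth_torus_DERIV[OF sl(2), of x]
  have pos: "\<rho> t x > 0" by (rule sl)
  have eqs: "deriv (\<lambda>s. \<rho> s x) t + deriv (m t) x = 0"
    "deriv (\<lambda>s. m s x) t + deriv (\<lambda>y. (m t y)\<^sup>2 / \<rho> t y) x + deriv (\<lambda>y. P (\<rho> t y)) x
        = \<beta> * deriv (\<lambda>y. \<mu> (\<rho> t y) * deriv (\<lambda>z. m t z / \<rho> t z) y) x"
    using sol t by (auto simp: cns_solution_def)
  have "((\<lambda>y. (m t y)\<^sup>2 / \<rho> t y) has_real_derivative
      2 * m t x * deriv (m t) x / \<rho> t x - (m t x)\<^sup>2 * deriv (\<rho> t) x / (\<rho> t x)\<^sup>2) (at x)"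
    using pos by (auto intro!: derivative_eq_intros dx simp: field_simps power2_eq_square)
  then have d1: "deriv (\<lambda>y. (m t y)\<^sup>2 / \<rho> t y) x =
      2 * m t x * deriv (m t) x / \<rho> t x - (m t x)\<^sup>2 * deriv (\<rho> t) x / (\<rho> t x)\<^sup>2"
    by (rule DERIV_imp_deriv)
  have "(P has_real_derivative deriv P (\<rho> t x)) (at (\<rho> t x))"
    using smooth_on_DERIV[OF P] pos by blast
  then have d2: "deriv (\<lambda>y. P (\<rho> t y)) x = deriv P (\<rho> t x) * deriv (\<rho> t) x"
    by (intro DERIV_imp_deriv DERIV_chain2[OF _ dx(1)])
  note eqs' = eqs[unfolded d1 d2 DERIV_imp_deriv[OF \<rho>t] DERIV_imp_deriv[OF mt]]
  show ?thesis
    unfolding DERIV_imp_deriv[OF entropy_DERIV[where f = "\<lambda>s. \<rho> s x" and g = "\<lambda>s. m s x", OF Q pos \<rho>t mt]]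
      DERIV_imp_deriv[OF entropy_flux_DERIV[where f = "\<rho> t" and g = "m t", OF Q pos dx]]
    by (rule entropy_balance_algebra[OF pos eqs'])
qed

lemma cns_entropy_inequality:
  assumes "is_P_hat P Q" "smooth_on {0<..} P" "cns_solution 0 P \<mu> J \<rho> m" "t \<in> J"
  shows "deriv (\<lambda>s. entropy Q (\<rho> s x) (m s x)) t
    + deriv (\<lambda>y. entropy_flux Q (\<rho> t y) (m t y)) x \<le> 0"
proof -
  obtain \<rho>t mt where "((\<lambda>s. \<rho> s x) has_real_derivative \<rho>t t x) (at t)"
    "((\<lambda>s. m s x) has_real_derivative mt t x) (at t)"
    using cns_solution_time_derivative[OF assms(3)] assms(4) by metis
  from cns_entropy_balance[OF assms this] show ?thesis by simp
qed

lemma cns_total_entropy_DERIV: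
  assumes Q: "is_P_hat P Q" and P: "smooth_on {0<..} P" and \<mu>: "smooth_on {0<..} \<mu>"
    and J: "open J" and sol: "cns_solution \<beta> P \<mu> J \<rho> m" and t: "t \<in> J"
  shows "((\<lambda>s. total_entropy Q (\<rho> s) (m s)) has_real_derivative
    - \<beta> * torus_integral (\<lambda>x. \<bar>deriv (\<lambda>y. m t y / \<rho> t y) x\<bar>\<^sup>2 * \<mu> (\<rho> t x))) (at t)"
proof -
  obtain \<rho>t mt where
    ct: "continuous_on (J \<times> UNIV) (\<lambda>(t, x). \<rho>t t x)" "continuous_on (J \<times> UNIV) (\<lambda>(t, x). mt t x)"
    and dt: "\<And>t x. t \<in> J \<Longrightarrow> ((\<lambda>s. \<rho> s x) has_real_derivative \<rho>t t x) (at t)"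
      "\<And>t x. t \<in> J \<Longrightarrow> ((\<lambda>s. m s x) has_real_derivative mt t x) (at t)"
    using cns_solution_time_derivative[OF sol] by metis
  note sl = cns_solution_slice[OF sol]
  \<comment> \<open>The time derivative of the entropy density, as given by the chain rule.\<close>
  define g where "g = (\<lambda>s x. m s x * mt s x / \<rho> s x - (m s x)\<^sup>2 * \<rho>t s x / (2 * (\<rho> s x)\<^sup>2)
    + deriv Q (\<rho> s x) * \<rho>t s x)"
  have dG: "((\<lambda>s. entropy Q (\<rho> s x) (m s x)) has_real_derivative g s x) (at s)" if "s \<in> J" for s x
    unfolding g_def using entropy_DERIV[OF Q _ dt(1)[OF that] dt(2)[OF that]] sl(3)[OF that] by blast
  have cont: "continuous_on (J \<times> UNIV) (\<lambda>z. \<rho> (fst z) (snd z))"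
    "continuous_on (J \<times> UNIV) (\<lambda>z. m (fst z) (snd z))"
    "continuous_on (J \<times> UNIV) (\<lambda>z. \<rho>t (fst z) (snd z))"
    "continuous_on (J \<times> UNIV) (\<lambda>z. mt (fst z) (snd z))"
    using sol ct by (auto simp: cns_solution_def case_prod_unfold intro: smooth_on_continuous_on)
  have cQ: "continuous_on (J \<times> UNIV) (\<lambda>z. deriv Q (\<rho> (fst z) (snd z)))"
    by (rule continuous_on_compose2[OF is_P_hat_continuous_on(2)[OF Q] cont(1)]) (auto intro: sl(3))
  have cg: "continuous_on (J \<times> UNIV) (\<lambda>(s, x). g s x)"
    unfolding g_def case_prod_unfold
    by (intro continuous_intros cont cQ ballI) (use sl(3) in \<open>force dest: less_imp_neq\<close>)+
  have cG: "continuous_on {0..1} (\<lambda>x. entropy Q (\<rho> s x) (m s x))" if "s \<in> J" for s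
  proof -
    note c = smooth_torus_continuous_on[OF sl(1)[OF that]] smooth_torus_continuous_on[OF sl(2)[OF that]]
    have "continuous_on {0..1} (\<lambda>x. Q (\<rho> s x))"
      by (rule continuous_on_compose2[OF is_P_hat_continuous_on(1)[OF Q] c(1)]) (auto intro: sl(3)[OF that])
    moreover have "\<rho> s x \<noteq> 0" for x
      using sl(3)[OF that, of x] by simp
    ultimately show ?thesis
      unfolding entropy_def by (intro continuous_intros c) auto
  qed
  \<comment> \<open>The Leibniz rule asks for a convex set of times, so it is applied on a ball
    inside \<open>J\<close>. As the ball is open, the derivative within it is the derivative at
    \<open>t\<close>.\<close>
  obtain e where e: "e > 0" "ball t e \<subseteq> J"
    using J t openE by blast
  have "((\<lambda>s. integral (cbox 0 1) (\<lambda>x. entropy Q (\<rho> s x) (m s x))) has_field_derivative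
      integral (cbox 0 1) (g t)) (at t within ball t e)"
  proof (rule leibniz_rule_field_derivative)
    show "((\<lambda>s. entropy Q (\<rho> s x) (m s x)) has_field_derivative g s x) (at s within ball t e)"
      if "s \<in> ball t e" for s x
      using dG that e(2) by (blast intro: DERIV_subset)
    show "(\<lambda>x. entropy Q (\<rho> s x) (m s x)) integrable_on cbox 0 1" if "s \<in> ball t e" for s
      using integrable_continuous_real[OF cG[of s]] that e(2) by auto
    show "continuous_on (ball t e \<times> cbox 0 1) (\<lambda>(s, x). g s x)"
      by (rule continuous_on_subset[OF cg]) (use e(2) in auto)
  qed (use e(1) in auto)
  then have lim: "((\<lambda>s. total_entropy Q (\<rho> s) (m s)) has_real_derivative torus_integral (g t)) (at t)"
    unfolding total_entropy_def torus_integral_def cbox_interval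
    using at_within_open[OF _ open_ball, of t t e] e(1) by (metis centre_in_ball)
  define v where "v = (\<lambda>x. m t x / \<rho> t x)"
  define D where "D = (\<lambda>x. deriv v x * deriv v x * \<mu> (\<rho> t x))"
  \<comment> \<open>Chosen so that its derivative is \<open>g t x + \<beta> * D x\<close>:
    differentiating the viscous product gives the dissipation plus the right-hand side of the
    entropy balance, and subtracting the flux turns the latter into the time derivative of the
    entropy.\<close>
  define \<Phi> where "\<Phi> = (\<lambda>x. \<beta> * (v x * (\<mu> (\<rho> t x) * deriv v x)) - entropy_flux Q (\<rho> t x) (m t x))"
  have v: "smooth_torus v"
    unfolding v_def by (intro smooth_torus_divide sl t)
  have \<mu>\<rho>: "smooth_torus (\<lambda>x. \<mu> (\<rho> t x))"
    by (rule smooth_torus_compose[OF \<mu> sl(1,3)[OF t]])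
  have f: "smooth_torus (\<lambda>x. \<mu> (\<rho> t x) * deriv v x)"
    by (intro smooth_torus_mult \<mu>\<rho> smooth_torus_deriv v)
  have D: "smooth_torus D"
    unfolding D_def by (intro smooth_torus_mult \<mu>\<rho> smooth_torus_deriv v)
  have d\<Phi>: "(\<Phi> has_real_derivative g t x + \<beta> * D x) (at x)" for x
  proof -
    let ?F = "\<lambda>y. entropy_flux Q (\<rho> t y) (m t y)"
    note F = entropy_flux_DERIV[where f = "\<rho> t" and g = "m t" and x = x, OF Q sl(3)[OF t]
        smooth_torus_DERIV[OF sl(1)[OF t]] smooth_torus_DERIV[OF sl(2)[OF t]]]
    \<comment> \<open>The explicit derivative of the flux is folded back into
      \<open>deriv ?F x\<close>, the form in which it occurs in the balance.\<close>
    have "(?F has_real_derivative deriv ?F x) (at x)"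
      unfolding DERIV_imp_deriv[OF F] by (rule F)
    then have d: "(\<Phi> has_real_derivative
        \<beta> * (deriv v x * (\<mu> (\<rho> t x) * deriv v x) + deriv (\<lambda>x. \<mu> (\<rho> t x) * deriv v x) x * v x) - deriv ?F x) (at x)"
      unfolding \<Phi>_def
      by (rule DERIV_diff[OF DERIV_cmult[OF DERIV_mult[OF smooth_torus_DERIV[OF v] smooth_torus_DERIV[OF f]]]])
    have balance: "g t x + deriv ?F x = v x * (\<beta> * deriv (\<lambda>y. \<mu> (\<rho> t y) * deriv v y) x)"
      using cns_entropy_balance[OF Q P sol t dt(1)[OF t] dt(2)[OF t]]
      unfolding DERIV_imp_deriv[OF dG[OF t]] v_def .
    have "\<beta> * (deriv v x * (\<mu> (\<rho> t x) * deriv v x) + deriv (\<lambda>x. \<mu> (\<rho> t x) * deriv v x) x * v x) - deriv ?F x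
        = g t x + \<beta> * D x"
      unfolding eq_diff_eq[THEN iffD2, OF balance] D_def by (simp add: ring_distribs mult_ac)
    with d show ?thesis by (simp only:)
  qed
  have "torus_integral (\<lambda>x. g t x + \<beta> * D x) = \<Phi> 1 - \<Phi> 0"
    by (rule torus_integral_derivative[OF d\<Phi>])
  \<comment> \<open>All ingredients of \<open>\<Phi>\<close> are periodic, so the boundary terms
    cancel.\<close>
  also have "\<Phi> 1 = \<Phi> 0"
  proof -
    have "h 1 = h 0" if "smooth_torus h" for h
      using that by (metis smooth_torus_def torus_periodic_def add_0)
    note p = this[OF sl(1)[OF t]] this[OF sl(2)[OF t]] this[OF v] this[OF smooth_torus_deriv[OF v]]
    show ?thesis unfolding \<Phi>_def p ..
  qed
  \<comment> \<open>Substituted into the left-hand side of the calculation. Integrability of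
    \<open>g t\<close> is read off from the joint continuity of \<open>g\<close>.\<close>
  also have "torus_integral (\<lambda>x. g t x + \<beta> * D x) = torus_integral (g t) + \<beta> * torus_integral D"
  proof -
    have "continuous_on {0..1} (g t)"
    proof -
      have "continuous_on {0..1} (\<lambda>x. (t, x))"
        by (intro continuous_intros)
      from continuous_on_compose2[OF cg this] t show ?thesis by auto
    qed
    then show ?thesis
      using smooth_torus_integrable[OF D]
      by (simp add: torus_integral_def integral_add integrable_continuous_real integrable_on_mult_right)
  qed
  finally have "torus_integral (g t) = - \<beta> * torus_integral D" by simp
  with lim show ?thesis
    by (simp add: D_def v_def power2_eq_square)
qed

text \<open>Potentials and first variations enter through description operators, so the conclusion
  also records that potentials exist, that the metric does not depend on their choice, and that the
  described first variation has its defining property. The dissipation identity includes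
  differentiability of the total entropy in time.\<close>

theorem mainTheorem2:
  fixes \<beta> :: real and P \<mu> :: "real \<Rightarrow> real"
  assumes "\<beta> > 0"
    and "smooth_on {0<..} P"
    and "smooth_on {0<..} \<mu>"
    and "\<And>r. r > 0 \<Longrightarrow> \<mu> r > 0"
  shows
    "(\<exists>Q. is_P_hat P Q) \<and>
     (\<forall>Q. is_P_hat P Q \<longrightarrow>
        (\<forall>J \<rho> m. open J \<longrightarrow> cns_solution 0 P \<mu> J \<rho> m \<longrightarrow>
           (\<forall>t\<in>J. \<forall>x.
              deriv (\<lambda>s. entropy Q (\<rho> s x) (m s x)) t
              + deriv (\<lambda>y. entropy_flux Q (\<rho> t y) (m t y)) x \<le> 0))) \<and>
     (\<forall>c1 c2. \<forall>u\<in>state_space c1 c2. c1 > 0 \<longrightarrow>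
        (\<forall>X\<in>tangent_space. \<exists>\<psi>. is_potential \<mu> u X \<psi>) \<and>
        (\<forall>X\<in>tangent_space. \<forall>Y\<in>tangent_space. \<forall>\<psi>1 \<psi>2.
           is_potential \<mu> u X \<psi>1 \<longrightarrow> is_potential \<mu> u Y \<psi>2 \<longrightarrow>
           metric_g \<mu> u X Y =
             torus_integral (\<lambda>x. deriv \<psi>1 x * deriv \<psi>2 x * \<mu> (fst u x))) \<and>
        degenerate_metric_on tangent_space (metric_g \<mu> u)) \<and>
     (\<forall>Q. is_P_hat P Q \<longrightarrow>
        (\<forall>\<rho> m. smooth_torus \<rho> \<longrightarrow> smooth_torus m \<longrightarrow> (\<forall>x. \<rho> x > 0) \<longrightarrow>
           is_first_variation_m (total_entropy Q) \<rho> m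
             (first_variation_m (total_entropy Q) \<rho> m) \<and>
           fisher_information \<mu> (total_entropy Q) \<rho> m =
             torus_integral (\<lambda>x. \<bar>deriv (\<lambda>y. m y / \<rho> y) x\<bar>\<^sup>2 * \<mu> (\<rho> x))) \<and>
        (\<forall>J \<rho> m. open J \<longrightarrow> cns_solution \<beta> P \<mu> J \<rho> m \<longrightarrow>
           (\<forall>t\<in>J.
              ((\<lambda>s. total_entropy Q (\<rho> s) (m s)) has_real_derivative
                 - \<beta> * fisher_information \<mu> (total_entropy Q) (\<rho> t) (m t)) (at t) \<and>
              - \<beta> * fisher_information \<mu> (total_entropy Q) (\<rho> t) (m t) \<le> 0)))"
proof (intro conjI allI impI ballI)
  show "\<exists>Q. is_P_hat P Q"
    by (rule ex_P_hat[OF assms(2)])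
next
  fix Q J \<rho> m t x
  assume "is_P_hat P Q" "cns_solution 0 P \<mu> J \<rho> m" "t \<in> J"
  then show "deriv (\<lambda>s. entropy Q (\<rho> s x) (m s x)) t
      + deriv (\<lambda>y. entropy_flux Q (\<rho> t y) (m t y)) x \<le> 0"
    using cns_entropy_inequality assms(2) by blast
next
  fix c1 c2 u
  assume "u \<in> state_space c1 c2"
  then have u: "smooth_torus (fst u)" "\<And>x. fst u x > 0"
    by (auto simp: state_space_def)
  \<comment> \<open>The viscosity evaluated along the density is the positive weight of the
    potential equation.\<close>
  have a: "smooth_torus (\<lambda>x. \<mu> (fst u x))" "\<And>x. \<mu> (fst u x) > 0"
    using smooth_torus_compose[OF assms(3) u] assms(4) u(2) by blast+
  show ex: "\<exists>\<psi>. is_potential \<mu> u X \<psi>" if "X \<in> tangent_space" for X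
  proof -
    have "smooth_torus (snd X)" "torus_integral (snd X) = 0"
      using that by (auto simp: tangent_space_def)
    from ex_potential[OF a this] show ?thesis
      unfolding is_potential_def by metis
  qed
  show "metric_g \<mu> u X Y = torus_integral (\<lambda>x. deriv \<psi>1 x * deriv \<psi>2 x * \<mu> (fst u x))"
    if "is_potential \<mu> u X \<psi>1" "is_potential \<mu> u Y \<psi>2" for X Y \<psi>1 \<psi>2
    by (rule metric_g_eq[OF a that])
  show "degenerate_metric_on tangent_space (metric_g \<mu> u)"
    by (rule degenerate_metric_on_metric_g[OF a ex])
next
  fix Q \<rho> m
  assume *: "is_P_hat P Q" "smooth_torus \<rho>" "smooth_torus m" "\<forall>x. \<rho> x > 0"
  then show "is_first_variation_m (total_entropy Q) \<rho> m (first_variation_m (total_entropy Q) \<rho> m)"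
    using first_variation_m_entropy is_first_variation_m_entropy by metis
  show "fisher_information \<mu> (total_entropy Q) \<rho> m =
      torus_integral (\<lambda>x. \<bar>deriv (\<lambda>y. m y / \<rho> y) x\<bar>\<^sup>2 * \<mu> (\<rho> x))"
    using * by (intro fisher_information_entropy) auto
next
  fix Q J \<rho> m t
  assume *: "is_P_hat P Q" "open J" "cns_solution \<beta> P \<mu> J \<rho> m" "t \<in> J"
  note sl = cns_solution_slice[OF *(3,4)]
  note fi = fisher_information_entropy[OF *(1) sl(1,3,2), of \<mu>]
  show "((\<lambda>s. total_entropy Q (\<rho> s) (m s)) has_real_derivative
      - \<beta> * fisher_information \<mu> (total_entropy Q) (\<rho> t) (m t)) (at t)"
    unfolding fi by (rule cns_total_entropy_DERIV[OF *(1) assms(2,3) *(2-4)])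
  let ?w = "deriv (\<lambda>y. m t y / \<rho> t y)"
  have "torus_integral (\<lambda>x. ?w x * ?w x * \<mu> (\<rho> t x)) \<ge> 0"
  proof (rule torus_integral_nonneg)
    show "smooth_torus (\<lambda>x. ?w x * ?w x * \<mu> (\<rho> t x))"
      by (intro smooth_torus_mult smooth_torus_deriv smooth_torus_divide
          smooth_torus_compose[OF assms(3)] sl)
    show "?w x * ?w x * \<mu> (\<rho> t x) \<ge> 0" for x
      using assms(4)[OF sl(3)] by (simp add: less_imp_le)
  qed
  with assms(1) show "- \<beta> * fisher_information \<mu> (total_entropy Q) (\<rho> t) (m t) \<le> 0"
    unfolding fi by (simp add: power2_eq_square)
qed

end
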